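(* The constructive behavioral semantics $\mathrm{CBS}$ and the (start and resumption) constructive state semantics $\mathrm{CSS}_s,\mathrm{CSS}_r$ of loop-free Kernel Esterel are equivalent in the following sense, where $\mathcal E$ is the expansion function on terms: 1. For all statements $p$, events $E,E'$, $k\in\mathbb N$ and terms $\bar p'$: $\mathrm{CSS}_s(p,E,E',k,\bar p')\implies \mathrm{CBS}(p,E,E',k,\mathcal E(\bar p'))$. 2. For all states $\hat p$, events $E,E'$, $k\in\mathbb N$ and terms $\bar p'$: $\mathrm{CSS}_r(\hat p,E,E',k,\bar p')\implies \mathrm{CBS}(\mathcal E(\hat p),E,E',k,\mathcal E(\bar p'))$. 3. For all statements $p,p'$, events $E,E'$ and $k\in\mathbb N$: $\mathrm{CBS}(p,E,E',k,p')\implies$ there exists a term $\bar p''$ with $\mathrm{CSS}_s(p,E,E',k,\bar p'')$ and $p'=\mathcal E(\bar p'')$. 4. For all states $\hat p$, statements $p'$, events $E,E'$ and $k\in\mathbb N$: $\mathrm{CBS}(\mathcal E(\hat p),E,E',k,p')\implies$ there exists a term $\bar p''$ with $\mathrm{CSS}_r(\hat p,E,E',k,\bar p'')$ and $p'=\mathcal E(\bar p'')$.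
   Context: **Syntax.** Fix an infinite set of signals with decidable equality. A literal $\ell$ is $s$ or $\neg s$ ($s$ a signal). Statements (loop-free Kernel Esterel): $p,q ::= 0 \mid 1 \mid k\ (k\ge 2) \mid\ !s \mid @\ell \mid s?p,q \mid s\supset p \mid \{p\} \mid\ \uparrow p \mid p;q \mid p|q \mid p\backslash s$ (nothing, pause, exit, emit, await immediate, presence test, suspend, trap, shift, sequence, parallel, local signal declaration). **Codes.** Completion codes are naturals. $\downarrow0=0,\downarrow1=1,\downarrow2=0,\downarrow n=n-1$ ($n\ge3$); $\uparrow0=0,\uparrow1=1,\uparrow n=n+1$ ($n\ge2$). Both extend elementwise to sets; $\mathrm{Max}(K,L)=\{\max(k,l):k\in K,l\in L\}$. **Events.** Statuses: $\bot,+,-$. An event $E$ is a finite partial map from signals to statuses. $E(s):=\bot$ if $s\notin\mathrm{dom}(E)$; $E(\neg s):=\neg E(s)$ with $\neg+=-,\neg-=+,\neg\bot=\bot$. $E*s^b$ has domain $\mathrm{dom}(E)\cup\{s\}$, maps $s$ to $b$ and agrees with $E$ elsewhere. Given input event $E$, output events are maps with domain $\mathrm{dom}(E)$: $\emptyset$ maps everything to $-$; $\{s^+\}$ maps $s$ to $+$ and the rest to $-$; $E_1\cup E_2$ is pointwise with $+\vee x=x\vee+=+$, $-\vee-=-$, and $\bot$ otherwise. For $E'$ with domain $\mathrm{dom}(E)\cup\{s\}$, $E'\setminus s$ is the map on $\mathrm{dom}(E)$ agreeing with $E'$ off $s$ and mapping $s$ to $-$ if $s\in\mathrm{dom}(E)$.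 **Must/Can.** For $m\in\{+,\bot\}$, $\mathrm{Must}(p,E)$ and $\mathrm{Can}^m(p,E)$ are pairs (set of signals, set of codes), with components indexed $s$, $k$; unions and inclusions are componentwise; $X\setminus 0$ removes code $0$, $X\setminus s$ removes signal $s$. By mutual recursion: - $\mathrm{Must}(k,E)=\mathrm{Can}^m(k,E)=(\emptyset,\{k\})$ for $k\ge0$; $\mathrm{Must}(!s,E)=\mathrm{Can}^m(!s,E)=(\{s\},\{0\})$. - $@\ell$: both are $(\emptyset,\{0\})$ if $E(\ell)=+$, $(\emptyset,\{1\})$ if $E(\ell)=-$; otherwise Must is $(\emptyset,\emptyset)$ and $\mathrm{Can}^m$ is $(\emptyset,\{0,1\})$. - $s?p,q$: if $E(s)=+$, the value (Must, resp. $\mathrm{Can}^m$) for $p$; if $E(s)=-$, that for $q$; otherwise Must is $(\emptyset,\emptyset)$ and $\mathrm{Can}^m$ is $\mathrm{Can}^\bot(p,E)\cup\mathrm{Can}^\bot(q,E)$. - $s\supset p$: same as $p$. $\{p\}$ (resp. $\uparrow p$): same signals as $p$, codes mapped by $\downarrow$ (resp. $\uparrow$). - $\mathrm{Must}(p;q,E)=\mathrm{Must}(p,E)$ if $0\notin\mathrm{Must}_k(p,E)$, else $(\mathrm{Must}_s(p,E)\cup\mathrm{Must}_s(q,E),\mathrm{Must}_k(q,E))$. $\mathrm{Can}^m(p;q,E)=\mathrm{Can}^m(p,E)$ if $0\notin\mathrm{Can}^m_k(p,E)$; else $(\mathrm{Can}^m(p,E)\setminus0)\cup\mathrm{Can}^+(q,E)$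 if $0\in\mathrm{Must}_k(p,E)$ and $m=+$; else $(\mathrm{Can}^m(p,E)\setminus0)\cup\mathrm{Can}^\bot(q,E)$. - $p|q$: union of signals, $\mathrm{Max}$ of code sets (for Must and for $\mathrm{Can}^m$). - $\mathrm{Must}(p\backslash s,E)=\mathrm{Must}(p,E*s^b)\setminus s$ with $b=+$ if $s\in\mathrm{Must}_s(p,E*s^\bot)$; else $b=-$ if $s\notin\mathrm{Can}^+_s(p,E*s^\bot)$; else $b=\bot$. $\mathrm{Can}^m(p\backslash s,E)=\mathrm{Can}^m(p,E*s^b)\setminus s$ with $b=+$ if $s\in\mathrm{Must}_s(p,E*s^\bot)$ and $m=+$; else $b=-$ if $s\notin\mathrm{Can}^m_s(p,E*s^\bot)$; else $b=\bot$. **CBS.** $\delta(k,p)=p$ if $k=1$, and $0$ otherwise. $\mathrm{CBS}(p,E,E',k,p')$ is the least relation closed under: - $\mathrm{CBS}(k,E,\emptyset,k,0)$ for all $k\ge0$; $\mathrm{CBS}(!s,E,\{s^+\},0,0)$ if $s\in\mathrm{dom}(E)$. - $\mathrm{CBS}(@\ell,E,\emptyset,0,0)$ if $E(\ell)=+$; $\mathrm{CBS}(@\ell,E,\emptyset,1,@\ell)$ if $E(\ell)=-$. - If $E(s)=+$ and $\mathrm{CBS}(p,E,E',k,p')$ then $\mathrm{CBS}(s?p,q,\ E,E',k,p')$; if $E(s)=-$ and $\mathrm{CBS}(q,E,E',k,q')$ then $\mathrm{CBS}(s?p,q,\ E,E',k,q')$. - If $\mathrm{CBS}(p,E,E',k,p')$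 then: $\mathrm{CBS}(s\supset p,E,E',k,\delta(k,\ @\neg s;(s\supset p')))$ provided $s\in\mathrm{dom}(E)$; $\mathrm{CBS}(\{p\},E,E',\downarrow k,\delta(\downarrow k,\{p'\}))$ — where, if $k\neq1$, then $\downarrow k\ne1$; $\mathrm{CBS}(\uparrow p,E,E',\uparrow k,\delta(\uparrow k,\uparrow p'))$; and, if $k\neq0$, $\mathrm{CBS}(p;q,E,E',k,\delta(k,p';q))$. - If $\mathrm{CBS}(p,E,E'_p,0,p')$ and $\mathrm{CBS}(q,E,E'_q,k,q')$ then $\mathrm{CBS}(p;q,E,E'_p\cup E'_q,k,q')$. - If $\mathrm{CBS}(p,E,E'_p,k_p,p')$ and $\mathrm{CBS}(q,E,E'_q,k_q,q')$, with $k=\max(k_p,k_q)$, then $\mathrm{CBS}(p|q,E,E'_p\cup E'_q,k,\delta(k,p'|q'))$. - If $s\in\mathrm{Must}_s(p,E*s^\bot)$ and $\mathrm{CBS}(p,E*s^+,E',k,p')$, or if $s\notin\mathrm{Can}^+_s(p,E*s^\bot)$ and $\mathrm{CBS}(p,E*s^-,E',k,p')$, then $\mathrm{CBS}(p\backslash s,E,E'\setminus s,k,\delta(k,p'\backslash s))$. **States and terms.** States: $\hat p,\hat q ::= \hat1 \mid \widehat{@\ell} \mid s?\hat p,q \mid s?p,\hat q \mid s\supset\hat p \mid \{\hat p\} \mid\ \uparrow\hat p \mid \hat p;q \mid p;\hat q \mid \hat p|q \mid p|\hat q \mid \hat p|\hat q \mid \hat p\backslash s$ ($p,q$ statements). A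 term $\bar p$ is a state or a statement (disjoint union). A constructor applied to terms yields a state if one of its components is a state, a statement otherwise. $\mathcal B(\bar p)$ is the statement obtained by erasing all hats. Below, inside a rule, $p$ denotes $\mathcal B(\hat p)$ when $\hat p$ is given. For a term $\bar t$, $\delta(k,\bar t)=\bar t$ if $k=1$ and $\mathcal B(\bar t)$ otherwise. **Expansion.** $\mathcal E(p)=0$ for $p$ a statement; on states: $\mathcal E(\hat1)=0$, $\mathcal E(\widehat{@\ell})=@\ell$, $\mathcal E(s?\hat p,q)=\mathcal E(\hat p)$, $\mathcal E(s?p,\hat q)=\mathcal E(\hat q)$, $\mathcal E(s\supset\hat p)=@\neg s;(s\supset\mathcal E(\hat p))$, $\mathcal E(\{\hat p\})=\{\mathcal E(\hat p)\}$, $\mathcal E(\uparrow\hat p)=\uparrow\mathcal E(\hat p)$, $\mathcal E(\hat p;q)=\mathcal E(\hat p);q$, $\mathcal E(p;\hat q)=\mathcal E(\hat q)$, $\mathcal E(\hat p|\hat q)=\mathcal E(\hat p)|\mathcal E(\hat q)$, $\mathcal E(\hat p|q)=\mathcal E(\hat p)|0$, $\mathcal E(p|\hat q)=0|\mathcal E(\hat q)$, $\mathcal E(\hat p\backslash s)=\mathcal E(\hat p)\backslash s$. **Start semantics** $\mathrm{CSS}_s(p,E,E',k,\bar p')$, least relation with: - $\mathrm{CSS}_s(0,E,\emptyset,0,0)$; $\mathrm{CSS}_s(1,E,\emptyset,1,\hat1)$; $\mathrm{CSS}_s(k,E,\emptyset,k,k)$ for $k\ge2$; $\mathrm{CSS}_s(!s,E,\{s^+\},0,!s)$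 if $s\in\mathrm{dom}(E)$; $\mathrm{CSS}_s(@\ell,E,\emptyset,0,@\ell)$ if $E(\ell)=+$; $\mathrm{CSS}_s(@\ell,E,\emptyset,1,\widehat{@\ell})$ if $E(\ell)=-$. - If $E(s)=+$ and $\mathrm{CSS}_s(p,E,E',k,\bar p')$: $\mathrm{CSS}_s(s?p,q,\ E,E',k,\delta(k,\ s?\bar p',q))$. If $E(s)=-$ and $\mathrm{CSS}_s(q,E,E',k,\bar q')$: $\mathrm{CSS}_s(s?p,q,\ E,E',k,\delta(k,\ s?p,\bar q'))$. - If $\mathrm{CSS}_s(p,E,E',k,\bar p')$: $\mathrm{CSS}_s(s\supset p,E,E',k,\delta(k,s\supset\bar p'))$ if $s\in\mathrm{dom}(E)$; $\mathrm{CSS}_s(\{p\},E,E',\downarrow k,\delta(\downarrow k,\{\bar p'\}))$; $\mathrm{CSS}_s(\uparrow p,E,E',\uparrow k,\delta(\uparrow k,\uparrow\bar p'))$; if $k\ne0$, $\mathrm{CSS}_s(p;q,E,E',k,\delta(k,\bar p';q))$. - If $\mathrm{CSS}_s(p,E,E'_p,0,p)$ and $\mathrm{CSS}_s(q,E,E'_q,k,\bar q')$: $\mathrm{CSS}_s(p;q,E,E'_p\cup E'_q,k,\delta(k,p;\bar q'))$. - If $\mathrm{CSS}_s(p,E,E'_p,k_p,\bar p')$, $\mathrm{CSS}_s(q,E,E'_q,k_q,\bar q')$, $k=\max(k_p,k_q)$: $\mathrm{CSS}_s(p|q,E,E'_p\cup E'_q,k,\delta(k,\bar p'|\bar q'))$.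 - If $s\in\mathrm{Must}_s(p,E*s^\bot)$ and $\mathrm{CSS}_s(p,E*s^+,E',k,\bar p')$, or $s\notin\mathrm{Can}^+_s(p,E*s^\bot)$ and $\mathrm{CSS}_s(p,E*s^-,E',k,\bar p')$: $\mathrm{CSS}_s(p\backslash s,E,E'\setminus s,k,\delta(k,\bar p'\backslash s))$. **Resumption semantics** $\mathrm{CSS}_r(\hat p,E,E',k,\bar p')$, least relation with: - $\mathrm{CSS}_r(\hat1,E,\emptyset,0,1)$; $\mathrm{CSS}_r(\widehat{@\ell},E,\emptyset,0,@\ell)$ if $E(\ell)=+$; $\mathrm{CSS}_r(\widehat{@\ell},E,\emptyset,1,\widehat{@\ell})$ if $E(\ell)=-$. - If $\mathrm{CSS}_r(\hat p,E,E',k,\bar p')$: $\mathrm{CSS}_r(s?\hat p,q,\ E,E',k,\delta(k,\ s?\bar p',q))$; $\mathrm{CSS}_r(\{\hat p\},E,E',\downarrow k,\delta(\downarrow k,\{\bar p'\}))$; $\mathrm{CSS}_r(\uparrow\hat p,E,E',\uparrow k,\delta(\uparrow k,\uparrow\bar p'))$; $\mathrm{CSS}_r(\hat p|q,E,E',k,\delta(k,\bar p'|q))$; if $k\neq0$, $\mathrm{CSS}_r(\hat p;q,E,E',k,\delta(k,\bar p';q))$; if $E(s)=-$, $\mathrm{CSS}_r(s\supset\hat p,E,E',k,\delta(k,s\supset\bar p'))$. - $\mathrm{CSS}_r(s\supset\hat p,E,\emptyset,1,s\supset\hat p)$ if $E(s)=+$. - If $\mathrm{CSS}_r(\hat q,E,E',k,\bar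 q')$: $\mathrm{CSS}_r(s?p,\hat q,\ E,E',k,\delta(k,\ s?p,\bar q'))$; $\mathrm{CSS}_r(p;\hat q,E,E',k,\delta(k,p;\bar q'))$; $\mathrm{CSS}_r(p|\hat q,E,E',k,\delta(k,p|\bar q'))$. - If $\mathrm{CSS}_r(\hat p,E,E'_p,0,p)$ and $\mathrm{CSS}_s(q,E,E'_q,k,\bar q')$: $\mathrm{CSS}_r(\hat p;q,E,E'_p\cup E'_q,k,\delta(k,p;\bar q'))$. - If $\mathrm{CSS}_r(\hat p,E,E'_p,k_p,\bar p')$, $\mathrm{CSS}_r(\hat q,E,E'_q,k_q,\bar q')$, $k=\max(k_p,k_q)$: $\mathrm{CSS}_r(\hat p|\hat q,E,E'_p\cup E'_q,k,\delta(k,\bar p'|\bar q'))$. - If $s\in\mathrm{Must}_s(\mathcal E(\hat p),E*s^\bot)$ and $\mathrm{CSS}_r(\hat p,E*s^+,E',k,\bar p')$, or $s\notin\mathrm{Can}^+_s(\mathcal E(\hat p),E*s^\bot)$ and $\mathrm{CSS}_r(\hat p,E*s^-,E',k,\bar p')$: $\mathrm{CSS}_r(\hat p\backslash s,E,E'\setminus s,k,\delta(k,\bar p'\backslash s))$. *)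

theory Defs
  imports Main "HOL-Library.Finite_Map"
begin

datatype 's literal = PosLit 's | NegLit 's

text \<open>
  The statements 0 (nothing), 1 (pause) and k (exit, for k at least 2) are the instances of the
  single constructor \<open>Exit\<close>.
\<close>

datatype 's stmt =
    Exit nat
  | Emit 's
  | Await "'s literal"
  | Test 's "'s stmt" "'s stmt"
  | Suspend 's "'s stmt"
  | Trap "'s stmt"
  | Shift "'s stmt"
  | Seq "'s stmt" "'s stmt"
  | Par "'s stmt" "'s stmt"
  | Local "'s stmt" 's

definition down :: "nat \<Rightarrow> nat" where
  "down k = (if k = 1 then 1 else if k \<le> 2 then 0 else k - 1)"

definition up :: "nat \<Rightarrow> nat" where
  "up k = (if k \<le> 1 then k else k + 1)"

definition Max_codes :: "nat set \<Rightarrow> nat set \<Rightarrow> nat set" where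
  "Max_codes K L = {max k l | k l. k \<in> K \<and> l \<in> L}"

datatype status = Unknown | Present | Absent

type_synonym 's event = "('s, status) fmap"

fun status_neg :: "status \<Rightarrow> status" where
  "status_neg Unknown = Unknown"
| "status_neg Present = Absent"
| "status_neg Absent = Present"

fun status_or :: "status \<Rightarrow> status \<Rightarrow> status" where
  "status_or Present _ = Present"
| "status_or _ Present = Present"
| "status_or Absent Absent = Absent"
| "status_or _ _ = Unknown"

definition sig_status :: "'s event \<Rightarrow> 's \<Rightarrow> status" where
  "sig_status E s = (case fmlookup E s of None \<Rightarrow> Unknown | Some b \<Rightarrow> b)"

fun lit_status :: "'s event \<Rightarrow> 's literal \<Rightarrow> status" where
  "lit_status E (PosLit s) = sig_status E s"
| "lit_status E (NegLit s) = status_neg (sig_status E s)"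

text \<open>
  The event written \<open>E * s\<^sup>b\<close> is \<open>fmupd s b E\<close>. The operations on output events take the input
  event \<open>E\<close> as first argument; their results all have the same domain as \<open>E\<close>.
\<close>

definition out_empty :: "'s event \<Rightarrow> 's event" where
  "out_empty E = fmmap_keys (\<lambda>_ _. Absent) E"

definition out_single :: "'s event \<Rightarrow> 's \<Rightarrow> 's event" where
  "out_single E s = fmmap_keys (\<lambda>x _. if x = s then Present else Absent) E"

definition out_union :: "'s event \<Rightarrow> 's event \<Rightarrow> 's event \<Rightarrow> 's event" where
  "out_union E E1 E2 =
     fmmap_keys (\<lambda>x _. status_or (sig_status E1 x) (sig_status E2 x)) E"

text \<open>Here \<open>E'\<close> has the domain of \<open>E\<close> extended by \<open>s\<close>.\<close>

definition out_hide :: "'s event \<Rightarrow> 's event \<Rightarrow> 's \<Rightarrow> 's event" where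
  "out_hide E E' s = fmmap_keys (\<lambda>x _. if x = s then Absent else sig_status E' x) E"

text \<open>The superscript of Can, a status among \<open>+\<close> and \<open>\<bottom>\<close>.\<close>

datatype can_mode = ModePlus | ModeBot

text \<open>First component: signals; second component: completion codes.\<close>

type_synonym 's analysis = "'s set \<times> nat set"

definition an_union :: "'s analysis \<Rightarrow> 's analysis \<Rightarrow> 's analysis" where
  "an_union X Y = (fst X \<union> fst Y, snd X \<union> snd Y)"

definition an_remove_code :: "'s analysis \<Rightarrow> nat \<Rightarrow> 's analysis" where
  "an_remove_code X k = (fst X, snd X - {k})"

definition an_remove_sig :: "'s analysis \<Rightarrow> 's \<Rightarrow> 's analysis" where
  "an_remove_sig X s = (fst X - {s}, snd X)"

fun Must :: "'s stmt \<Rightarrow> 's event \<Rightarrow> 's analysis"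
  and Can :: "can_mode \<Rightarrow> 's stmt \<Rightarrow> 's event \<Rightarrow> 's analysis"
where
  "Must (Exit k) E = ({}, {k})"
| "Must (Emit s) E = ({s}, {0})"
| "Must (Await l) E =
     (case lit_status E l of
        Present \<Rightarrow> ({}, {0})
      | Absent \<Rightarrow> ({}, {1})
      | Unknown \<Rightarrow> ({}, {}))"
| "Must (Test s p q) E =
     (case sig_status E s of
        Present \<Rightarrow> Must p E
      | Absent \<Rightarrow> Must q E
      | Unknown \<Rightarrow> ({}, {}))"
| "Must (Suspend s p) E = Must p E"
| "Must (Trap p) E = (fst (Must p E), down ` snd (Must p E))"
| "Must (Shift p) E = (fst (Must p E), up ` snd (Must p E))"
| "Must (Seq p q) E =
     (if 0 \<notin> snd (Must p E) then Must p E
      else (fst (Must p E) \<union> fst (Must q E), snd (Must q E)))"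
| "Must (Par p q) E =
     (fst (Must p E) \<union> fst (Must q E), Max_codes (snd (Must p E)) (snd (Must q E)))"
| "Must (Local p s) E =
     an_remove_sig
       (if s \<in> fst (Must p (fmupd s Unknown E)) then Must p (fmupd s Present E)
        else if s \<notin> fst (Can ModePlus p (fmupd s Unknown E)) then Must p (fmupd s Absent E)
        else Must p (fmupd s Unknown E)) s"
| "Can m (Exit k) E = ({}, {k})"
| "Can m (Emit s) E = ({s}, {0})"
| "Can m (Await l) E =
     (case lit_status E l of
        Present \<Rightarrow> ({}, {0})
      | Absent \<Rightarrow> ({}, {1})
      | Unknown \<Rightarrow> ({}, {0, 1}))"
| "Can m (Test s p q) E =
     (case sig_status E s of
        Present \<Rightarrow> Can m p E
      | Absent \<Rightarrow> Can m q E
      | Unknown \<Rightarrow> an_union (Can ModeBot p E) (Can ModeBot q E))"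
| "Can m (Suspend s p) E = Can m p E"
| "Can m (Trap p) E = (fst (Can m p E), down ` snd (Can m p E))"
| "Can m (Shift p) E = (fst (Can m p E), up ` snd (Can m p E))"
| "Can m (Seq p q) E =
     (if 0 \<notin> snd (Can m p E) then Can m p E
      else if 0 \<in> snd (Must p E) \<and> m = ModePlus
      then an_union (an_remove_code (Can m p E) 0) (Can ModePlus q E)
      else an_union (an_remove_code (Can m p E) 0) (Can ModeBot q E))"
| "Can m (Par p q) E =
     (fst (Can m p E) \<union> fst (Can m q E), Max_codes (snd (Can m p E)) (snd (Can m q E)))"
| "Can m (Local p s) E =
     an_remove_sig
       (if s \<in> fst (Must p (fmupd s Unknown E)) \<and> m = ModePlus
        then Can m p (fmupd s Present E)
        else if s \<notin> fst (Can m p (fmupd s Unknown E)) then Can m p (fmupd s Absent E)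
        else Can m p (fmupd s Unknown E)) s"

definition delta :: "nat \<Rightarrow> 's stmt \<Rightarrow> 's stmt" where
  "delta k p = (if k = 1 then p else Exit 0)"

inductive CBS :: "'s stmt \<Rightarrow> 's event \<Rightarrow> 's event \<Rightarrow> nat \<Rightarrow> 's stmt \<Rightarrow> bool" where
  Exit: "CBS (Exit k) E (out_empty E) k (Exit 0)"
| Emit: "s \<in> fmdom' E \<Longrightarrow> CBS (Emit s) E (out_single E s) 0 (Exit 0)"
| Await_present: "lit_status E l = Present \<Longrightarrow> CBS (Await l) E (out_empty E) 0 (Exit 0)"
| Await_absent: "lit_status E l = Absent \<Longrightarrow> CBS (Await l) E (out_empty E) 1 (Await l)"
| Test_present:
    "sig_status E s = Present \<Longrightarrow> CBS p E E' k p' \<Longrightarrow> CBS (Test s p q) E E' k p'"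
| Test_absent:
    "sig_status E s = Absent \<Longrightarrow> CBS q E E' k q' \<Longrightarrow> CBS (Test s p q) E E' k q'"
| Suspend:
    "s \<in> fmdom' E \<Longrightarrow> CBS p E E' k p' \<Longrightarrow>
     CBS (Suspend s p) E E' k (delta k (Seq (Await (NegLit s)) (Suspend s p')))"
| Trap: "CBS p E E' k p' \<Longrightarrow> CBS (Trap p) E E' (down k) (delta (down k) (Trap p'))"
| Shift: "CBS p E E' k p' \<Longrightarrow> CBS (Shift p) E E' (up k) (delta (up k) (Shift p'))"
| Seq_stop: "CBS p E E' k p' \<Longrightarrow> k \<noteq> 0 \<Longrightarrow> CBS (Seq p q) E E' k (delta k (Seq p' q))"
| Seq_go:
    "CBS p E Ep 0 p' \<Longrightarrow> CBS q E Eq k q' \<Longrightarrow> CBS (Seq p q) E (out_union E Ep Eq) k q'"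
| Par:
    "CBS p E Ep kp p' \<Longrightarrow> CBS q E Eq kq q' \<Longrightarrow> k = max kp kq \<Longrightarrow>
     CBS (Par p q) E (out_union E Ep Eq) k (delta k (Par p' q'))"
| Local_present:
    "s \<in> fst (Must p (fmupd s Unknown E)) \<Longrightarrow> CBS p (fmupd s Present E) E' k p' \<Longrightarrow>
     CBS (Local p s) E (out_hide E E' s) k (delta k (Local p' s))"
| Local_absent:
    "s \<notin> fst (Can ModePlus p (fmupd s Unknown E)) \<Longrightarrow> CBS p (fmupd s Absent E) E' k p' \<Longrightarrow>
     CBS (Local p s) E (out_hide E E' s) k (delta k (Local p' s))"

text \<open>The suffix L, R or B tells which component of a binary constructor is active.\<close>

datatype 's state =
    StPause
  | StAwait "'s literal"
  | StTestL 's "'s state" "'s stmt"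
  | StTestR 's "'s stmt" "'s state"
  | StSuspend 's "'s state"
  | StTrap "'s state"
  | StShift "'s state"
  | StSeqL "'s state" "'s stmt"
  | StSeqR "'s stmt" "'s state"
  | StParL "'s state" "'s stmt"
  | StParR "'s stmt" "'s state"
  | StParB "'s state" "'s state"
  | StLocal "'s state" 's

datatype 's trm = Stmt "'s stmt" | State "'s state"

primrec base_state :: "'s state \<Rightarrow> 's stmt" where
  "base_state StPause = Exit 1"
| "base_state (StAwait l) = Await l"
| "base_state (StTestL s p q) = Test s (base_state p) q"
| "base_state (StTestR s p q) = Test s p (base_state q)"
| "base_state (StSuspend s p) = Suspend s (base_state p)"
| "base_state (StTrap p) = Trap (base_state p)"
| "base_state (StShift p) = Shift (base_state p)"
| "base_state (StSeqL p q) = Seq (base_state p) q"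
| "base_state (StSeqR p q) = Seq p (base_state q)"
| "base_state (StParL p q) = Par (base_state p) q"
| "base_state (StParR p q) = Par p (base_state q)"
| "base_state (StParB p q) = Par (base_state p) (base_state q)"
| "base_state (StLocal p s) = Local (base_state p) s"

fun base :: "'s trm \<Rightarrow> 's stmt" where
  "base (Stmt p) = p"
| "base (State p) = base_state p"

definition tdelta :: "nat \<Rightarrow> 's trm \<Rightarrow> 's trm" where
  "tdelta k t = (if k = 1 then t else Stmt (base t))"

text \<open>
  A statement constructor applied to terms yields a state as soon as one component is a state.
  In the binary case of \<open>Test\<close> and \<open>Seq\<close>, at most the component named by the suffix can be one.
\<close>

fun tTestL :: "'s \<Rightarrow> 's trm \<Rightarrow> 's stmt \<Rightarrow> 's trm" where
  "tTestL s (Stmt p) q = Stmt (Test s p q)"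
| "tTestL s (State p) q = State (StTestL s p q)"

fun tTestR :: "'s \<Rightarrow> 's stmt \<Rightarrow> 's trm \<Rightarrow> 's trm" where
  "tTestR s p (Stmt q) = Stmt (Test s p q)"
| "tTestR s p (State q) = State (StTestR s p q)"

fun tSuspend :: "'s \<Rightarrow> 's trm \<Rightarrow> 's trm" where
  "tSuspend s (Stmt p) = Stmt (Suspend s p)"
| "tSuspend s (State p) = State (StSuspend s p)"

fun tTrap :: "'s trm \<Rightarrow> 's trm" where
  "tTrap (Stmt p) = Stmt (Trap p)"
| "tTrap (State p) = State (StTrap p)"

fun tShift :: "'s trm \<Rightarrow> 's trm" where
  "tShift (Stmt p) = Stmt (Shift p)"
| "tShift (State p) = State (StShift p)"

fun tSeqL :: "'s trm \<Rightarrow> 's stmt \<Rightarrow> 's trm" where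
  "tSeqL (Stmt p) q = Stmt (Seq p q)"
| "tSeqL (State p) q = State (StSeqL p q)"

fun tSeqR :: "'s stmt \<Rightarrow> 's trm \<Rightarrow> 's trm" where
  "tSeqR p (Stmt q) = Stmt (Seq p q)"
| "tSeqR p (State q) = State (StSeqR p q)"

fun tPar :: "'s trm \<Rightarrow> 's trm \<Rightarrow> 's trm" where
  "tPar (Stmt p) (Stmt q) = Stmt (Par p q)"
| "tPar (State p) (Stmt q) = State (StParL p q)"
| "tPar (Stmt p) (State q) = State (StParR p q)"
| "tPar (State p) (State q) = State (StParB p q)"

fun tLocal :: "'s trm \<Rightarrow> 's \<Rightarrow> 's trm" where
  "tLocal (Stmt p) s = Stmt (Local p s)"
| "tLocal (State p) s = State (StLocal p s)"

primrec expand_state :: "'s state \<Rightarrow> 's stmt" where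
  "expand_state StPause = Exit 0"
| "expand_state (StAwait l) = Await l"
| "expand_state (StTestL s p q) = expand_state p"
| "expand_state (StTestR s p q) = expand_state q"
| "expand_state (StSuspend s p) = Seq (Await (NegLit s)) (Suspend s (expand_state p))"
| "expand_state (StTrap p) = Trap (expand_state p)"
| "expand_state (StShift p) = Shift (expand_state p)"
| "expand_state (StSeqL p q) = Seq (expand_state p) q"
| "expand_state (StSeqR p q) = expand_state q"
| "expand_state (StParL p q) = Par (expand_state p) (Exit 0)"
| "expand_state (StParR p q) = Par (Exit 0) (expand_state q)"
| "expand_state (StParB p q) = Par (expand_state p) (expand_state q)"
| "expand_state (StLocal p s) = Local (expand_state p) s"

fun expand :: "'s trm \<Rightarrow> 's stmt" where
  "expand (Stmt p) = Exit 0"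
| "expand (State p) = expand_state p"

inductive CSS_s :: "'s stmt \<Rightarrow> 's event \<Rightarrow> 's event \<Rightarrow> nat \<Rightarrow> 's trm \<Rightarrow> bool" where
  Nothing: "CSS_s (Exit 0) E (out_empty E) 0 (Stmt (Exit 0))"
| Pause: "CSS_s (Exit 1) E (out_empty E) 1 (State StPause)"
| Exit: "k \<ge> 2 \<Longrightarrow> CSS_s (Exit k) E (out_empty E) k (Stmt (Exit k))"
| Emit: "s \<in> fmdom' E \<Longrightarrow> CSS_s (Emit s) E (out_single E s) 0 (Stmt (Emit s))"
| Await_present:
    "lit_status E l = Present \<Longrightarrow> CSS_s (Await l) E (out_empty E) 0 (Stmt (Await l))"
| Await_absent:
    "lit_status E l = Absent \<Longrightarrow> CSS_s (Await l) E (out_empty E) 1 (State (StAwait l))"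
| Test_present:
    "sig_status E s = Present \<Longrightarrow> CSS_s p E E' k p' \<Longrightarrow>
     CSS_s (Test s p q) E E' k (tdelta k (tTestL s p' q))"
| Test_absent:
    "sig_status E s = Absent \<Longrightarrow> CSS_s q E E' k q' \<Longrightarrow>
     CSS_s (Test s p q) E E' k (tdelta k (tTestR s p q'))"
| Suspend:
    "s \<in> fmdom' E \<Longrightarrow> CSS_s p E E' k p' \<Longrightarrow>
     CSS_s (Suspend s p) E E' k (tdelta k (tSuspend s p'))"
| Trap: "CSS_s p E E' k p' \<Longrightarrow> CSS_s (Trap p) E E' (down k) (tdelta (down k) (tTrap p'))"
| Shift: "CSS_s p E E' k p' \<Longrightarrow> CSS_s (Shift p) E E' (up k) (tdelta (up k) (tShift p'))"
| Seq_stop: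
    "CSS_s p E E' k p' \<Longrightarrow> k \<noteq> 0 \<Longrightarrow> CSS_s (Seq p q) E E' k (tdelta k (tSeqL p' q))"
| Seq_go:
    "CSS_s p E Ep 0 (Stmt p) \<Longrightarrow> CSS_s q E Eq k q' \<Longrightarrow>
     CSS_s (Seq p q) E (out_union E Ep Eq) k (tdelta k (tSeqR p q'))"
| Par:
    "CSS_s p E Ep kp p' \<Longrightarrow> CSS_s q E Eq kq q' \<Longrightarrow> k = max kp kq \<Longrightarrow>
     CSS_s (Par p q) E (out_union E Ep Eq) k (tdelta k (tPar p' q'))"
| Local_present:
    "s \<in> fst (Must p (fmupd s Unknown E)) \<Longrightarrow> CSS_s p (fmupd s Present E) E' k p' \<Longrightarrow>
     CSS_s (Local p s) E (out_hide E E' s) k (tdelta k (tLocal p' s))"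
| Local_absent:
    "s \<notin> fst (Can ModePlus p (fmupd s Unknown E)) \<Longrightarrow> CSS_s p (fmupd s Absent E) E' k p' \<Longrightarrow>
     CSS_s (Local p s) E (out_hide E E' s) k (tdelta k (tLocal p' s))"

inductive CSS_r :: "'s state \<Rightarrow> 's event \<Rightarrow> 's event \<Rightarrow> nat \<Rightarrow> 's trm \<Rightarrow> bool" where
  Pause: "CSS_r StPause E (out_empty E) 0 (Stmt (Exit 1))"
| Await_present:
    "lit_status E l = Present \<Longrightarrow> CSS_r (StAwait l) E (out_empty E) 0 (Stmt (Await l))"
| Await_absent:
    "lit_status E l = Absent \<Longrightarrow> CSS_r (StAwait l) E (out_empty E) 1 (State (StAwait l))"
| TestL:
    "CSS_r p E E' k p' \<Longrightarrow> CSS_r (StTestL s p q) E E' k (tdelta k (tTestL s p' q))"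
| TestR:
    "CSS_r q E E' k q' \<Longrightarrow> CSS_r (StTestR s p q) E E' k (tdelta k (tTestR s p q'))"
| Suspend_go:
    "CSS_r p E E' k p' \<Longrightarrow> sig_status E s = Absent \<Longrightarrow>
     CSS_r (StSuspend s p) E E' k (tdelta k (tSuspend s p'))"
| Suspend_stop:
    "sig_status E s = Present \<Longrightarrow>
     CSS_r (StSuspend s p) E (out_empty E) 1 (State (StSuspend s p))"
| Trap: "CSS_r p E E' k p' \<Longrightarrow> CSS_r (StTrap p) E E' (down k) (tdelta (down k) (tTrap p'))"
| Shift: "CSS_r p E E' k p' \<Longrightarrow> CSS_r (StShift p) E E' (up k) (tdelta (up k) (tShift p'))"
| SeqL_stop:
    "CSS_r p E E' k p' \<Longrightarrow> k \<noteq> 0 \<Longrightarrow> CSS_r (StSeqL p q) E E' k (tdelta k (tSeqL p' q))"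
| SeqL_go:
    "CSS_r p E Ep 0 (Stmt (base_state p)) \<Longrightarrow> CSS_s q E Eq k q' \<Longrightarrow>
     CSS_r (StSeqL p q) E (out_union E Ep Eq) k (tdelta k (tSeqR (base_state p) q'))"
| SeqR:
    "CSS_r q E E' k q' \<Longrightarrow> CSS_r (StSeqR p q) E E' k (tdelta k (tSeqR p q'))"
| ParL:
    "CSS_r p E E' k p' \<Longrightarrow> CSS_r (StParL p q) E E' k (tdelta k (tPar p' (Stmt q)))"
| ParR:
    "CSS_r q E E' k q' \<Longrightarrow> CSS_r (StParR p q) E E' k (tdelta k (tPar (Stmt p) q'))"
| ParB:
    "CSS_r p E Ep kp p' \<Longrightarrow> CSS_r q E Eq kq q' \<Longrightarrow> k = max kp kq \<Longrightarrow>
     CSS_r (StParB p q) E (out_union E Ep Eq) k (tdelta k (tPar p' q'))"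
| Local_present:
    "s \<in> fst (Must (expand_state p) (fmupd s Unknown E)) \<Longrightarrow>
     CSS_r p (fmupd s Present E) E' k p' \<Longrightarrow>
     CSS_r (StLocal p s) E (out_hide E E' s) k (tdelta k (tLocal p' s))"
| Local_absent:
    "s \<notin> fst (Can ModePlus (expand_state p) (fmupd s Unknown E)) \<Longrightarrow>
     CSS_r p (fmupd s Absent E) E' k p' \<Longrightarrow>
     CSS_r (StLocal p s) E (out_hide E E' s) k (tdelta k (tLocal p' s))"

end

theory Submission
  imports Defs
begin

text \<open>
  A step of either state semantics yields an active term exactly when the code is 1, and that term
  always erases to the original statement. Hence the expansion of the resulting term is 0 for every
  other code, as the behavioral semantics demands, and derivations correspond rule by rule.
  Inactive branches of a parallel, and the guard in the expansion of a suspension, contribute an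
  output event that is neutral for union.
\<close>

section \<open>Output events and the neutrality of the empty output\<close>

lemma dom_out [simp]:
  "fmdom' (out_empty E) = fmdom' E"
  "fmdom' (out_single E s) = fmdom' E"
  "fmdom' (out_union E E1 E2) = fmdom' E"
  "fmdom' (out_hide E E' s) = fmdom' E"
  by (auto simp: out_empty_def out_single_def out_union_def out_hide_def fmlookup_dom'_iff
      split: option.splits)

lemma CBS_dom: "CBS p E E' k p' \<Longrightarrow> fmdom' E' = fmdom' E"
  by (induction rule: CBS.induct) auto

lemma status_or_Absent [simp]: "status_or Absent b = b" "status_or b Absent = b"
  by (cases b; simp)+

lemma sig_status_out_empty: "x \<in> fmdom' E \<Longrightarrow> sig_status (out_empty E) x = Absent"
  by (auto simp: sig_status_def out_empty_def fmlookup_dom'_iff)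

text \<open>\<open>Absent\<close> is neutral for \<open>status_or\<close>. The domain hypothesis
  matters because \<open>out_union\<close> keeps exactly the signals of \<open>E\<close>;
  \<open>CBS_dom\<close> supplies it later.\<close>

lemma out_union_empty:
  assumes "fmdom' E' = fmdom' E"
  shows "out_union E (out_empty E) E' = E'" "out_union E E' (out_empty E) = E'"
proof -
  have "fmlookup (out_union E (out_empty E) E') x = fmlookup E' x \<and>
        fmlookup (out_union E E' (out_empty E)) x = fmlookup E' x" for x
  proof (cases "x \<in> fmdom' E")
    case True
    then obtain b b' where "fmlookup E x = Some b" "fmlookup E' x = Some b'"
      using assms by (metis fmlookup_dom'_iff)
    then show ?thesis
      using sig_status_out_empty[OF True] by (simp add: out_union_def sig_status_def)
  next
    case False
    then show ?thesis
      using assms by (simp add: out_union_def fmdom'_notD)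
  qed
  then show "out_union E (out_empty E) E' = E'" "out_union E E' (out_empty E) = E'"
    by (simp_all add: fmap_ext)
qed

section \<open>Shape of the terms produced by the state semantics\<close>

lemma down_eq_1 [simp]: "down k = 1 \<longleftrightarrow> k = 1" "down k = Suc 0 \<longleftrightarrow> k = Suc 0"
  by (auto simp: down_def)

lemma up_eq_1 [simp]: "up k = 1 \<longleftrightarrow> k = 1" "up k = Suc 0 \<longleftrightarrow> k = Suc 0"
  by (auto simp: up_def)

definition result_of :: "nat \<Rightarrow> 's stmt \<Rightarrow> 's trm \<Rightarrow> bool" where
  "result_of k p t \<longleftrightarrow> base t = p \<and> (k = 1 \<longleftrightarrow> (\<exists>q. t = State q))"

text \<open>Supplies the premise of the sequence rules that a terminated first component be
  literally its base statement.\<close>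

lemma result_of_0: "result_of 0 p t \<longleftrightarrow> t = Stmt p"
  by (cases t) (auto simp: result_of_def)

lemma result_of_cases:
  assumes "result_of k p t"
  obtains (active) q where "k = 1" "t = State q" "base_state q = p"
  | (inactive) "k \<noteq> 1" "t = Stmt p"
  using assms by (cases t) (auto simp: result_of_def)

lemma result_of_Stmt [simp]: "result_of k p (Stmt q) \<longleftrightarrow> k \<noteq> 1 \<and> p = q"
  and result_of_State [simp]: "result_of k p (State r) \<longleftrightarrow> k = 1 \<and> p = base_state r"
  by (auto simp: result_of_def)

lemma result_of_unary:
  assumes "result_of k p t"
  shows "result_of k (Test s p q) (tdelta k (tTestL s t q))"
    "result_of k (Test s q p) (tdelta k (tTestR s q t))"
    "result_of k (Suspend s p) (tdelta k (tSuspend s t))"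
    "result_of (down k) (Trap p) (tdelta (down k) (tTrap t))"
    "result_of (up k) (Shift p) (tdelta (up k) (tShift t))"
    "result_of k (Seq p q) (tdelta k (tSeqL t q))"
    "result_of k (Seq q p) (tdelta k (tSeqR q t))"
    "result_of k (Par p q) (tdelta k (tPar t (Stmt q)))"
    "result_of k (Par q p) (tdelta k (tPar (Stmt q) t))"
    "result_of k (Local p s) (tdelta k (tLocal t s))"
  using assms by (cases rule: result_of_cases; simp add: tdelta_def)+

text \<open>If the maximum is 1, some branch paused, so \<open>tPar\<close> gives a state; if it
  exceeds 1, \<open>tdelta\<close> erases any branch that paused.\<close>

lemma result_of_Par:
  assumes "result_of kp p t" "result_of kq q u" "k = max kp kq"
  shows "result_of k (Par p q) (tdelta k (tPar t u))"
  using assms by (elim result_of_cases) (auto simp: tdelta_def max_def)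

lemma CSS_s_result_of: "CSS_s p E E' k t \<Longrightarrow> result_of k p t"
  by (induction rule: CSS_s.induct) (simp_all add: result_of_unary result_of_Par)

lemma CSS_r_result_of: "CSS_r p E E' k t \<Longrightarrow> result_of k (base_state p) t"
  by (induction rule: CSS_r.induct)
    (simp_all add: result_of_unary result_of_Par CSS_s_result_of)

text \<open>For codes other than 1, \<open>expand t\<close> is already \<open>Exit 0\<close>. Hence
  \<open>tTestL\<close>, \<open>tTestR\<close> and \<open>tSeqR\<close> need no
  \<open>delta\<close>, just like the matching rules of \<open>CBS\<close>.\<close>

lemma expand_unary:
  assumes "result_of k p t"
  shows "expand (tdelta k (tTestL s t q)) = expand t"
    "expand (tdelta k (tTestR s q t)) = expand t"
    "expand (tdelta k (tSuspend s t)) = delta k (Seq (Await (NegLit s)) (Suspend s (expand t)))"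
    "expand (tdelta (down k) (tTrap t)) = delta (down k) (Trap (expand t))"
    "expand (tdelta (up k) (tShift t)) = delta (up k) (Shift (expand t))"
    "expand (tdelta k (tSeqL t q)) = delta k (Seq (expand t) q)"
    "expand (tdelta k (tSeqR q t)) = expand t"
    "expand (tdelta k (tPar t (Stmt q))) = delta k (Par (expand t) (Exit 0))"
    "expand (tdelta k (tPar (Stmt q) t)) = delta k (Par (Exit 0) (expand t))"
    "expand (tdelta k (tLocal t s)) = delta k (Local (expand t) s)"
  using assms by (cases rule: result_of_cases; simp add: tdelta_def delta_def)+

text \<open>A terminated branch beside a paused one expands to \<open>Exit 0\<close>, which is the
  idle branch in the expansions of \<open>StParL\<close> and \<open>StParR\<close>.\<close>

lemma expand_Par:
  assumes "result_of kp p t" "result_of kq q u" "k = max kp kq"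
  shows "expand (tdelta k (tPar t u)) = delta k (Par (expand t) (expand u))"
  using assms by (elim result_of_cases) (auto simp: tdelta_def delta_def max_def)

lemmas CSS_s_expand = expand_unary[OF CSS_s_result_of] expand_Par[OF CSS_s_result_of CSS_s_result_of]
lemmas CSS_r_expand = expand_unary[OF CSS_r_result_of] expand_Par[OF CSS_r_result_of CSS_r_result_of]

section \<open>Start semantics against behavioral semantics\<close>

lemma CSS_s_imp_CBS: "CSS_s p E E' k t \<Longrightarrow> CBS p E E' k (expand t)"
proof (induction rule: CSS_s.induct)
  case (Seq_go p E Ep q Eq k q')
  \<comment> \<open>The residue of the terminated component is absent from the rule's conclusion, so
    it is given here: \<open>expand (Stmt p)\<close> is \<open>Exit 0\<close>.\<close>
  then show ?case by (simp add: CSS_s_expand CBS.Seq_go[where p' = "Exit 0"])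
qed (simp_all add: CSS_s_expand CBS.intros del: One_nat_def)

lemma CBS_imp_CSS_s: "CBS p E E' k p' \<Longrightarrow> \<exists>t. CSS_s p E E' k t \<and> p' = expand t"
proof (induction rule: CBS.induct)
  case (Exit k E)
  \<comment> \<open>One rule of \<open>CBS\<close> covers what \<open>CSS_s\<close> splits into
    three.\<close>
  consider "k = 0" | "k = 1" | "k \<ge> 2" by linarith
  then show ?case
    by cases (fastforce intro: CSS_s.intros simp del: One_nat_def)+
next
  case (Seq_go p E Ep p' q Eq k q')
  then obtain t u where "CSS_s p E Ep 0 t" "CSS_s q E Eq k u" "q' = expand u"
    by blast
  then show ?case
    using CSS_s_result_of[of p E Ep 0 t]
    by (fastforce intro: CSS_s.Seq_go simp: result_of_0 CSS_s_expand)
qed ((fastforce intro: CSS_s.intros simp: CSS_s_expand simp del: One_nat_def)+)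

section \<open>Resumption semantics against behavioral semantics\<close>

lemma CSS_r_imp_CBS: "CSS_r p E E' k t \<Longrightarrow> CBS (expand_state p) E E' k (expand t)"
proof (induction rule: CSS_r.induct)
  case (Suspend_go p E E' k p' s)
  let ?guard = "Await (NegLit s)"
  \<comment> \<open>A signal outside the domain reads as \<open>Unknown\<close>, so a definite
    status places \<open>s\<close> inside it.\<close>
  have "s \<in> fmdom' E"
    using Suspend_go.hyps(2) by (auto simp: sig_status_def fmlookup_dom'_iff split: option.splits)
  then have "CBS (Suspend s (expand_state p)) E E' k (delta k (Seq ?guard (Suspend s (expand p'))))"
    using Suspend_go.IH by (rule CBS.Suspend)
  moreover have "CBS ?guard E (out_empty E) 0 (Exit 0)"
    using Suspend_go.hyps(2) by (simp add: CBS.Await_present)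
  ultimately show ?case
    using CBS.Seq_go CBS_dom[OF Suspend_go.IH] Suspend_go.hyps(1)
    by (fastforce simp: CSS_r_expand out_union_empty)
next
  case (Suspend_stop E s p)
  \<comment> \<open>The guard pauses with itself as residue, so \<open>CBS.Seq_stop\<close> rebuilds
    the whole expansion of the suspended state.\<close>
  have "CBS (Await (NegLit s)) E (out_empty E) 1 (Await (NegLit s))"
    using Suspend_stop by (simp add: CBS.Await_absent del: One_nat_def)
  then show ?case
    using CBS.Seq_stop[of _ _ _ 1] by (fastforce simp: delta_def)
next
  case (SeqL_go p E Ep q Eq k q')
  then show ?case
    by (simp add: CSS_s_expand CBS.Seq_go[where p' = "Exit 0"] CSS_s_imp_CBS)
next
  case (ParL p E E' k p' q)
  then show ?case
    \<comment> \<open>The idle branch runs as \<open>Exit 0\<close>: its code leaves the maximum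
      unchanged and its output is neutral.\<close>
    using CBS.Par[OF ParL.IH CBS.Exit[of 0 E]] CBS_dom[OF ParL.IH]
    by (simp add: CSS_r_expand out_union_empty)
next
  case (ParR q E E' k q' p)
  then show ?case
    using CBS.Par[OF CBS.Exit[of 0 E] ParR.IH] CBS_dom[OF ParR.IH]
    by (simp add: CSS_r_expand out_union_empty)
qed (simp_all add: CSS_r_expand CBS.intros del: One_nat_def)

inductive_cases CBS_ExitE: "CBS (Exit n) E E' k p'"
inductive_cases CBS_AwaitE: "CBS (Await l) E E' k p'"
inductive_cases CBS_SuspendE: "CBS (Suspend s p) E E' k p'"
inductive_cases CBS_TrapE: "CBS (Trap p) E E' k p'"
inductive_cases CBS_ShiftE: "CBS (Shift p) E E' k p'"
inductive_cases CBS_SeqE: "CBS (Seq p q) E E' k p'"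
inductive_cases CBS_ParE: "CBS (Par p q) E E' k p'"
inductive_cases CBS_LocalE: "CBS (Local p s) E E' k p'"

lemma status_neg_eq [simp]:
  "status_neg b = Present \<longleftrightarrow> b = Absent" "status_neg b = Absent \<longleftrightarrow> b = Present"
  by (cases b; simp)+

text \<open>The induction is on the state because \<open>expand_state\<close> is not injective:
  tests and right sequence positions vanish, so a \<open>CBS\<close> derivation does not determine
  the state. The event stays arbitrary since local declarations extend it.\<close>

lemma CBS_imp_CSS_r:
  "CBS (expand_state p) E E' k p' \<Longrightarrow> \<exists>t. CSS_r p E E' k t \<and> p' = expand t"
proof (induction p arbitrary: E E' k p')
  case StPause
  then show ?case by (fastforce elim: CBS_ExitE intro: CSS_r.Pause)
next
  case (StAwait l)
  from StAwait.prems have "CBS (Await l) E E' k p'" by simp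
  then show ?case
    by (cases rule: CBS_AwaitE) (fastforce intro: CSS_r.intros simp flip: One_nat_def)+
next
  case (StTestL s p q)
  then show ?case by (fastforce intro: CSS_r.TestL simp: CSS_r_expand)
next
  case (StTestR s q p)
  then show ?case by (fastforce intro: CSS_r.TestR simp: CSS_r_expand)
next
  case (StSuspend s p)
  let ?guard = "Await (NegLit s)"
  from StSuspend.prems consider
    (stop) g where "k \<noteq> 0" "CBS ?guard E E' k g"
      "p' = delta k (Seq g (Suspend s (expand_state p)))"
  | (go) Eg g Ep where "CBS ?guard E Eg 0 g" "CBS (Suspend s (expand_state p)) E Ep k p'"
      "E' = out_union E Eg Ep"
    by (auto elim: CBS_SeqE)
  then show ?case
  proof cases
    case stop
    \<comment> \<open>A nonzero code leaves only the pausing rule for the guard.\<close>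
    then have "sig_status E s = Present" "E' = out_empty E" "k = 1" "g = ?guard"
      by (auto elim: CBS_AwaitE)
    then show ?thesis
      using stop by (fastforce intro: CSS_r.Suspend_stop simp: delta_def simp flip: One_nat_def)
  next
    case go
    then have absent: "sig_status E s = Absent" and Eg: "Eg = out_empty E"
      by (auto elim: CBS_AwaitE)
    from go(2) obtain r where
      r: "CBS (expand_state p) E Ep k r" "p' = delta k (Seq ?guard (Suspend s r))"
      by (auto elim: CBS_SuspendE)
    moreover have "E' = Ep"
      using go Eg CBS_dom[OF r(1)] by (simp add: out_union_empty)
    ultimately show ?thesis
      using StSuspend.IH absent by (fastforce intro: CSS_r.Suspend_go simp: CSS_r_expand)
  qed
next
  case (StTrap p)
  then show ?case by (fastforce elim!: CBS_TrapE intro: CSS_r.Trap simp: CSS_r_expand)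
next
  case (StShift p)
  then show ?case by (fastforce elim!: CBS_ShiftE intro: CSS_r.Shift simp: CSS_r_expand)
next
  case (StSeqL p q)
  from StSeqL.prems consider
    (stop) r where "k \<noteq> 0" "CBS (expand_state p) E E' k r" "p' = delta k (Seq r q)"
  | (go) Ep r Eq where "CBS (expand_state p) E Ep 0 r" "CBS q E Eq k p'"
      "E' = out_union E Ep Eq"
    by (auto elim: CBS_SeqE)
  then show ?case
  proof cases
    case stop
    then show ?thesis
      using StSeqL.IH by (fastforce intro: CSS_r.SeqL_stop simp: CSS_r_expand)
  next
    case go
    \<comment> \<open>Once \<open>p\<close> terminates, \<open>q\<close> starts afresh, so the start
      semantics takes over.\<close>
    obtain t u where "CSS_r p E Ep 0 t" "CSS_s q E Eq k u" "p' = expand u"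
      using StSeqL.IH go CBS_imp_CSS_s by meson
    then show ?thesis
      using go CSS_r_result_of[of p E Ep 0 t]
      by (fastforce intro: CSS_r.SeqL_go simp: result_of_0 CSS_s_expand)
  qed
next
  case (StSeqR q p)
  then show ?case by (fastforce intro: CSS_r.SeqR simp: CSS_r_expand)
next
  case (StParL p q)
  then obtain Eq r where "CBS (expand_state p) E Eq k r" "E' = out_union E Eq (out_empty E)"
    "p' = delta k (Par r (Exit 0))"
    by (fastforce elim!: CBS_ParE elim: CBS_ExitE)
  then show ?case
    using StParL.IH CBS_dom
    by (fastforce intro: CSS_r.ParL simp: CSS_r_expand out_union_empty)
next
  case (StParR q p)
  then obtain Eq r where "CBS (expand_state p) E Eq k r" "E' = out_union E (out_empty E) Eq"
    "p' = delta k (Par (Exit 0) r)"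
    by (fastforce elim!: CBS_ParE elim: CBS_ExitE)
  then show ?case
    using StParR.IH CBS_dom
    by (fastforce intro: CSS_r.ParR simp: CSS_r_expand out_union_empty)
next
  case (StParB p q)
  from StParB.prems have "CBS (Par (expand_state p) (expand_state q)) E E' k p'" by simp
  then show ?case
    using StParB.IH by (fastforce elim!: CBS_ParE intro: CSS_r.ParB simp: CSS_r_expand)
next
  case (StLocal p s)
  \<comment> \<open>Both semantics analyse \<open>expand_state p\<close>, so the \<open>Must\<close>
    and \<open>Can\<close> side conditions carry over verbatim.\<close>
  from StLocal.prems have "CBS (Local (expand_state p) s) E E' k p'" by simp
  then show ?case
    using StLocal.IH
    by (elim CBS_LocalE)
      (fastforce intro: CSS_r.Local_present CSS_r.Local_absent simp: CSS_r_expand)+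
qed

theorem theorem8:
  assumes "infinite (UNIV :: 's set)"
  shows
    "(\<forall>(p :: 's stmt) (E :: 's event) (E' :: 's event) (k :: nat) (p' :: 's trm).
        CSS_s p E E' k p' \<longrightarrow> CBS p E E' k (expand p')) \<and>
     (\<forall>(p :: 's state) (E :: 's event) (E' :: 's event) (k :: nat) (p' :: 's trm).
        CSS_r p E E' k p' \<longrightarrow> CBS (expand (State p)) E E' k (expand p')) \<and>
     (\<forall>(p :: 's stmt) (p' :: 's stmt) (E :: 's event) (E' :: 's event) (k :: nat).
        CBS p E E' k p' \<longrightarrow> (\<exists>p'' :: 's trm. CSS_s p E E' k p'' \<and> p' = expand p'')) \<and>
     (\<forall>(p :: 's state) (p' :: 's stmt) (E :: 's event) (E' :: 's event) (k :: nat).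
        CBS (expand (State p)) E E' k p' \<longrightarrow>
        (\<exists>p'' :: 's trm. CSS_r p E E' k p'' \<and> p' = expand p''))"
  by (simp add: CSS_s_imp_CBS CSS_r_imp_CBS CBS_imp_CSS_s CBS_imp_CSS_r)

end
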